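(* Let $A$ and $B$ be $S$-sorted sets, and assume that the components $A_s$ and $B_s$ are all finite. Let $\mathcal{M}_1 := \operatorname{mPol} Q_A$ and $\mathcal{M}_2 := \operatorname{mPol} Q_B$ for $Q_A \subseteq \operatorname{Relp}(A)$ and $Q_B \subseteq \operatorname{Relp}(B)$. The following conditions are equivalent. (I) $\mathcal{M}_2 \in \mathsf{R}\,\mathcal{M}_1$. (II) There exists a reflection $(h,h')$ of $A$ into $B$ such that (i) $Q_B^{(h,h')} \subseteq [Q_A]$ and (ii) $[Q_A]_{(h,h')} \subseteq [Q_B]$.
   Context: Sorted sets and operations. $S$ is a set of sorts. An $S$-sorted set is a family $A=(A_s)_{s\in S}$ of sets; $S_A:=\{s\in S: A_s\ne\emptyset\}$. $W(S)$ is the set of finite words over $S$ including the empty word $\varepsilon$; for $w=s_1\dots s_n$, $A_w:=A_{s_1}\times\dots\times A_{s_n}$, $A_\varepsilon=\{\emptyset\}$. A declaration $(w,s)\in W(S)\times S$ is reasonable in $A$ if $A_w\ne\emptyset$ implies $A_s\ne\emptyset$. An $S$-sorted operation on $A$ of declaration $(w,s)$ is a function $f\colon A_w\to A_s$; $\operatorname{Op}(A)$ is the set of all of them. Relation pairs. An $m$-ary ($m\ge 0$) $S$-sorted relation on $A$ is a family $R=(R_s)_{s\in S}$ with $R_s\subseteq A_s^m$ (for $m=0$ each $R_s$ is $\emptyset$ or $\{\emptyset\}$); an $m$-ary relation pair is a pair $(R,R')$ of $m$-ary $S$-sorted relations, and $\operatorname{Relp}(A)$ is the set of relation pairs on $A$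 of all arities. An operation $f\colon A_w\to A_s$, $w=s_1\dots s_n$, preserves $(R,R')$ if for all $m$-tuples $r_i\in R_{s_i}$ ($i=1,\dots,n$) the $m$-tuple obtained by applying $f$ coordinatewise to $r_1,\dots,r_n$ is in $R'_s$. $\operatorname{mPol}Q$ is the set of $f\in\operatorname{Op}(A)$ preserving all pairs in $Q$; $\operatorname{mInv}F$ is the set of relation pairs preserved by all $f\in F$. For $A$ with finite components, $[Q]=\operatorname{mInv}\operatorname{mPol}Q$ is the minor-closure of $Q\subseteq\operatorname{Relp}(A)$. Reflections. A reflection of $A$ into $B$ is a pair $(h,h')$ of families $(h_s)_{s\in S_B}$, $(h'_s)_{s\in S_B}$ of maps $h_s\colon B_s\to A_s$, $h'_s\colon A_s\to B_s$ (it exists iff $S_B\subseteq S_A$). For $f\colon A_w\to A_s$ whose declaration is reasonable in $B$, $f_{(h,h')}\colon B_w\to B_s$ is the empty map if $B_w=\emptyset$, and otherwise $f_{(h,h')}(b_1,\dots,b_n):=h'_s(f(h_{s_1}(b_1),\dots,h_{s_n}(b_n)))$. For $F\subseteq\operatorname{Op}(A)$, if the declarations of all $f\in F$ are reasonable in $B$, then $F_{(h,h')}:=\{f_{(h,h')}:f\in F\}$; sets of this form are the reflections of $F$. $\mathsf R\,\mathcal M_1$ is the collection of all reflections of $\mathcal M_1$. For an $m$-ary $(R,R')\in\operatorname{Relp}(A)$, its reflection is $(R,R')_{(h,h')}:=(T,T')\in\operatorname{Relp}(B)$, where for $B_s\ne\emptyset$, $T_s=\{(b_1,\dots,b_m)\in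 B_s^m:(h_s(b_1),\dots,h_s(b_m))\in R_s\}$ and $T'_s=\{(h'_s(a_1),\dots,h'_s(a_m)):(a_1,\dots,a_m)\in R'_s\}$; for $B_s=\emptyset$, $T_s=T'_s=\emptyset$ (for every arity $m$). For an $m$-ary $(T,T')\in\operatorname{Relp}(B)$, its coreflection is $(T,T')^{(h,h')}:=(R,R')\in\operatorname{Relp}(A)$, where for $B_s\neq\emptyset$, $R_s=\{(h_s(b_1),\dots,h_s(b_m)):(b_1,\dots,b_m)\in T_s\}$ and $R'_s=\{(a_1,\dots,a_m)\in A_s^m:(h'_s(a_1),\dots,h'_s(a_m))\in T'_s\}$; for $B_s=\emptyset$, $R_s=R'_s=\emptyset$ (for every arity $m$). $Q_{(h,h')}$ and $Q^{(h,h')}$ are defined elementwise for sets $Q$ of relation pairs.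
   Formalization: The equivalence fails for some B with empty components; the formal version adds the assumption that, for each declaration (w,s) involving a sort t with B_t empty, M_1 has an operation of that declaration iff M_2 does (vacuous if all B_s are nonempty; implied by (I)). *)

theory Defs
  imports Main "HOL-Library.FuncSet"
begin

text \<open>
  An \<open>S\<close>-sorted set is a function \<open>A\<close> whose values at the sorts in \<open>S\<close> are the components; its
  values outside \<open>S\<close> are irrelevant.  The words over \<open>S\<close> are the elements of \<^term>\<open>lists S\<close>.
  Tuples are lists.
\<close>

definition nonempty_sorts :: "'s set \<Rightarrow> ('s \<Rightarrow> 'a set) \<Rightarrow> 's set" where
  "nonempty_sorts S A = {s \<in> S. A s \<noteq> {}}"

text \<open>The product \<open>A\<^sub>w\<close>; for the empty word it is the singleton of the empty list.\<close>

definition word_prod :: "('s \<Rightarrow> 'a set) \<Rightarrow> 's list \<Rightarrow> 'a list set" where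
  "word_prod A w = listset (map A w)"

definition reasonable :: "('s \<Rightarrow> 'a set) \<Rightarrow> 's list \<Rightarrow> 's \<Rightarrow> bool" where
  "reasonable A w s \<longleftrightarrow> (word_prod A w \<noteq> {} \<longrightarrow> A s \<noteq> {})"

text \<open>
  An operation carries its declaration \<open>(w, s)\<close>, so empty maps with different declarations are
  different operations.  The underlying map is \<^const>\<open>undefined\<close> outside \<open>A\<^sub>w\<close>, which makes
  equality of operations the equality of maps defined on \<open>A\<^sub>w\<close>.
\<close>

type_synonym ('s, 'a) operation = "'s list \<times> 's \<times> ('a list \<Rightarrow> 'a)"

definition Op :: "'s set \<Rightarrow> ('s \<Rightarrow> 'a set) \<Rightarrow> ('s, 'a) operation set" where
  "Op S A = {(w, s, f). w \<in> lists S \<and> s \<in> S \<and> f \<in> word_prod A w \<rightarrow>\<^sub>E A s}"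

definition tuples :: "nat \<Rightarrow> 'a set \<Rightarrow> 'a list set" where
  "tuples m X = {x \<in> lists X. length x = m}"

text \<open>
  For \<open>m = 0\<close> the components of a sorted relation are arbitrary subsets of the singleton of the empty
  list, also at sorts with \<open>A s = {}\<close>.
\<close>

definition sorted_relations :: "'s set \<Rightarrow> ('s \<Rightarrow> 'a set) \<Rightarrow> nat \<Rightarrow> ('s \<Rightarrow> 'a list set) set" where
  "sorted_relations S A m = (\<Pi>\<^sub>E s\<in>S. Pow (tuples m (A s)))"

text \<open>A relation pair \<open>(m, R, R')\<close> carries its arity \<open>m\<close>.\<close>

type_synonym ('s, 'a) relation_pair = "nat \<times> ('s \<Rightarrow> 'a list set) \<times> ('s \<Rightarrow> 'a list set)"

definition Relp :: "'s set \<Rightarrow> ('s \<Rightarrow> 'a set) \<Rightarrow> ('s, 'a) relation_pair set" where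
  "Relp S A = {(m, R, R'). R \<in> sorted_relations S A m \<and> R' \<in> sorted_relations S A m}"

text \<open>
  The \<open>m\<close>-tuple obtained by applying \<open>f\<close> coordinatewise to the list \<open>rs\<close> of \<open>m\<close>-tuples.  For the
  empty list \<open>rs\<close> this is the constant \<open>m\<close>-tuple with value \<open>f []\<close>.
\<close>

definition coordinatewise :: "nat \<Rightarrow> ('a list \<Rightarrow> 'a) \<Rightarrow> 'a list list \<Rightarrow> 'a list" where
  "coordinatewise m f rs = map (\<lambda>j. f (map (\<lambda>r. r ! j) rs)) [0..<m]"

fun preserves :: "('s, 'a) operation \<Rightarrow> ('s, 'a) relation_pair \<Rightarrow> bool" where
  "preserves (w, s, f) (m, R, R') \<longleftrightarrow> (\<forall>rs \<in> word_prod R w. coordinatewise m f rs \<in> R' s)"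

definition mPol :: "'s set \<Rightarrow> ('s \<Rightarrow> 'a set) \<Rightarrow> ('s, 'a) relation_pair set \<Rightarrow> ('s, 'a) operation set" where
  "mPol S A Q = {f \<in> Op S A. \<forall>q \<in> Q. preserves f q}"

definition mInv :: "'s set \<Rightarrow> ('s \<Rightarrow> 'a set) \<Rightarrow> ('s, 'a) operation set \<Rightarrow> ('s, 'a) relation_pair set" where
  "mInv S A F = {q \<in> Relp S A. \<forall>f \<in> F. preserves f q}"

definition minor_closure ::
  "'s set \<Rightarrow> ('s \<Rightarrow> 'a set) \<Rightarrow> ('s, 'a) relation_pair set \<Rightarrow> ('s, 'a) relation_pair set" where
  "minor_closure S A Q = mInv S A (mPol S A Q)"

text \<open>
  Reflections of \<open>A\<close> into \<open>B\<close>.  Only the values of \<open>h s\<close> on \<open>B s\<close> and of \<open>h' s\<close> on \<open>A s\<close>, for sorts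
  \<open>s\<close> with \<open>B s \<noteq> {}\<close>, enter the constructions below.
\<close>

definition is_reflection ::
  "'s set \<Rightarrow> ('s \<Rightarrow> 'a set) \<Rightarrow> ('s \<Rightarrow> 'b set) \<Rightarrow> ('s \<Rightarrow> 'b \<Rightarrow> 'a) \<Rightarrow> ('s \<Rightarrow> 'a \<Rightarrow> 'b) \<Rightarrow> bool" where
  "is_reflection S A B h h' \<longleftrightarrow>
     (\<forall>s \<in> nonempty_sorts S B. h s \<in> B s \<rightarrow> A s \<and> h' s \<in> A s \<rightarrow> B s)"

fun reflect_operation ::
  "('s \<Rightarrow> 'b set) \<Rightarrow> ('s \<Rightarrow> 'b \<Rightarrow> 'a) \<Rightarrow> ('s \<Rightarrow> 'a \<Rightarrow> 'b) \<Rightarrow> ('s, 'a) operation \<Rightarrow> ('s, 'b) operation" where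
  "reflect_operation B h h' (w, s, f) = (w, s, \<lambda>b \<in> word_prod B w. h' s (f (map2 h w b)))"

text \<open>The collection of all reflections of \<open>F\<close> that are sets of operations on \<open>B\<close>.\<close>

definition reflections ::
  "'s set \<Rightarrow> ('s \<Rightarrow> 'a set) \<Rightarrow> ('s \<Rightarrow> 'b set) \<Rightarrow> ('s, 'a) operation set \<Rightarrow> ('s, 'b) operation set set" where
  "reflections S A B F =
     {reflect_operation B h h' ` F | h h'.
        is_reflection S A B h h' \<and> (\<forall>(w, s, f) \<in> F. reasonable B w s)}"

fun reflect_relation_pair ::
  "'s set \<Rightarrow> ('s \<Rightarrow> 'b set) \<Rightarrow> ('s \<Rightarrow> 'b \<Rightarrow> 'a) \<Rightarrow> ('s \<Rightarrow> 'a \<Rightarrow> 'b)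
     \<Rightarrow> ('s, 'a) relation_pair \<Rightarrow> ('s, 'b) relation_pair" where
  "reflect_relation_pair S B h h' (m, R, R') =
     (m,
      \<lambda>s \<in> S. if B s = {} then {} else {b \<in> tuples m (B s). map (h s) b \<in> R s},
      \<lambda>s \<in> S. if B s = {} then {} else map (h' s) ` R' s)"

fun coreflect_relation_pair ::
  "'s set \<Rightarrow> ('s \<Rightarrow> 'a set) \<Rightarrow> ('s \<Rightarrow> 'b set) \<Rightarrow> ('s \<Rightarrow> 'b \<Rightarrow> 'a) \<Rightarrow> ('s \<Rightarrow> 'a \<Rightarrow> 'b)
     \<Rightarrow> ('s, 'b) relation_pair \<Rightarrow> ('s, 'a) relation_pair" where
  "coreflect_relation_pair S A B h h' (m, T, T') =
     (m,
      \<lambda>s \<in> S. if B s = {} then {} else map (h s) ` T s,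
      \<lambda>s \<in> S. if B s = {} then {} else {a \<in> tuples m (A s). map (h' s) a \<in> T' s})"

text \<open>
  A side condition on declarations \<open>(w, s)\<close> involving a sort at which \<open>B\<close> is empty: \<open>F\<close> has an
  operation of that declaration iff \<open>G\<close> has one.  It holds vacuously if all components of \<open>B\<close> are
  nonempty, and it holds whenever \<open>G\<close> is a reflection of \<open>F\<close> on \<open>B\<close>.  The
  relational conditions do not imply it, and without it the equivalence of membership of
  \<open>mPol Q\<^sub>B\<close> in the reflections of \<open>mPol Q\<^sub>A\<close> with the relational conditions is false,
  e.g. for a single sort, \<open>A = {0}\<close>, \<open>B = {}\<close>, \<open>Q\<^sub>A\<close> consisting of the unary pair \<open>({0}, {})\<close> and
  \<open>Q\<^sub>B\<close> empty: then \<open>mPol Q\<^sub>A\<close> is empty, but \<open>mPol Q\<^sub>B\<close> contains all empty maps.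
\<close>

definition agree_at_empty_sorts ::
  "'s set \<Rightarrow> ('s \<Rightarrow> 'b set) \<Rightarrow> ('s, 'a) operation set \<Rightarrow> ('s, 'b) operation set \<Rightarrow> bool" where
  "agree_at_empty_sorts S B F G \<longleftrightarrow>
     (\<forall>w \<in> lists S. \<forall>s \<in> S. (\<exists>t \<in> set (s # w). B t = {}) \<longrightarrow>
        ((\<exists>f. (w, s, f) \<in> F) \<longleftrightarrow> (\<exists>g. (w, s, g) \<in> G)))"

end

theory Submission
  imports Defs
begin

text \<open>
  Reflecting operations is dual to coreflecting relation pairs: at nonempty sorts, \<open>f\<close> preserves the
  coreflection of a pair iff the reflection of \<open>f\<close> preserves the pair
  (\<open>preserves_coreflect_iff\<close>), because both conditions unfold to the same statement about
  \<open>h' (f (h \<dots>))\<close>.  Since moreover an operation passes preservation on to reflections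
  (\<open>preserves_reflect\<close>), both relational conditions follow once \<open>M2\<close> is a reflection of \<open>M1\<close>, and
  the condition on coreflections makes the reflection of every member of \<open>M1\<close> a member of \<open>M2\<close>.

  It remains to see that the condition on reflections forces every \<open>g \<in> M2\<close>, of declaration \<open>(w, s)\<close>,
  to be the reflection of a member of \<open>M1\<close>.  As the components of \<open>B\<close> are finite, the elements of
  \<open>B\<^sub>w\<close> can be listed as \<open>b\<^sub>1, \<dots>, b\<^sub>m\<close>.  Let \<open>R\<close> consist of the \<open>m\<close>-tuples that list the \<open>h\<close>-images of
  the \<open>i\<close>-th entries of \<open>b\<^sub>1, \<dots>, b\<^sub>m\<close>, for the positions \<open>i\<close> of \<open>w\<close>, and let \<open>R'\<close> consist of the
  results of applying members of \<open>M1\<close> to tuples in \<open>R\<close>.  The pair \<open>(R, R')\<close> is then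
  invariant under \<open>M1\<close>, so \<open>g\<close> preserves its reflection.  Applied to the tuples of entries of
  \<open>b\<^sub>1, \<dots>, b\<^sub>m\<close>, this says that the value table of \<open>g\<close> is the \<open>h'\<close>-image of a tuple in \<open>R'\<close>.  Such a
  tuple arises from some \<open>f \<in> M1\<close> whose arguments are selected from the positions of \<open>w\<close>, that is,
  from a minor of \<open>f\<close> of declaration \<open>(w, s)\<close>; and \<open>M1\<close> is closed under minors (\<open>minor_in_mPol\<close>).
  The reflection of that minor is \<open>g\<close>.

  Declarations that involve an empty component of \<open>B\<close> carry only empty maps on \<open>B\<close>; for these,
  the agreement of the declarations present in \<open>M1\<close> and \<open>M2\<close> gives the claim directly.
\<close>

section \<open>Products along words and coordinatewise application\<close>

lemma in_word_prod_iff: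
  "x \<in> word_prod A w \<longleftrightarrow> length x = length w \<and> (\<forall>i<length w. x ! i \<in> A (w ! i))"
proof (induction w arbitrary: x)
  case Nil
  then show ?case by (simp add: word_prod_def)
next
  case (Cons s w)
  show ?case
    using Cons.IH by (cases x) (auto simp: word_prod_def set_Cons_def nth_Cons split: nat.splits)
qed

lemma word_prod_empty_iff: "word_prod A w = {} \<longleftrightarrow> (\<exists>t\<in>set w. A t = {})"
  by (induction w) (auto simp: word_prod_def set_Cons_def)

lemma finite_word_prod:
  assumes "\<And>t. t \<in> set w \<Longrightarrow> finite (A t)"
  shows "finite (word_prod A w)"
  using assms
proof (induction w)
  case Nil
  then show ?case by (simp add: word_prod_def)
next
  case (Cons s w)
  have "word_prod A (s # w) = (\<lambda>(x, xs). x # xs) ` (A s \<times> word_prod A w)"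
    by (auto simp: word_prod_def set_Cons_def)
  with Cons show ?case by simp
qed

lemma map2_in_word_prod:
  assumes "x \<in> word_prod X w"
    and "\<And>t y. t \<in> set w \<Longrightarrow> y \<in> X t \<Longrightarrow> \<phi> t y \<in> Y t"
  shows "map2 \<phi> w x \<in> word_prod Y w"
  using assms by (auto simp: in_word_prod_iff)

lemma column_in_word_prod:
  assumes "rs \<in> word_prod R w" and "\<And>t. t \<in> set w \<Longrightarrow> R t \<subseteq> tuples m (A t)" and "j < m"
  shows "map (\<lambda>r. r ! j) rs \<in> word_prod A w"
  unfolding in_word_prod_iff
proof (intro conjI allI impI)
  show "length (map (\<lambda>r. r ! j) rs) = length w"
    using assms(1) by (simp add: in_word_prod_iff)
  fix i assume i: "i < length w"
  then have "rs ! i \<in> tuples m (A (w ! i))"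
    using assms(1,2) by (meson in_word_prod_iff nth_mem subsetD)
  with i show "map (\<lambda>r. r ! j) rs ! i \<in> A (w ! i)"
    using assms(1,3) by (auto simp: in_word_prod_iff tuples_def in_lists_conv_set)
qed

lemma Relp_iff:
  "(m, R, R') \<in> Relp S A \<longleftrightarrow>
     R \<in> extensional S \<and> R' \<in> extensional S \<and>
     (\<forall>s\<in>S. R s \<subseteq> tuples m (A s) \<and> R' s \<subseteq> tuples m (A s))"
  by (auto simp: Relp_def sorted_relations_def PiE_iff)

lemma coordinatewise_in_tuples:
  assumes "f \<in> word_prod A w \<rightarrow> A s" and "rs \<in> word_prod R w"
    and "\<And>t. t \<in> set w \<Longrightarrow> R t \<subseteq> tuples m (A t)"
  shows "coordinatewise m f rs \<in> tuples m (A s)"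
  using assms(1) column_in_word_prod[OF assms(2,3)]
  by (auto simp: coordinatewise_def tuples_def in_lists_conv_set)

section \<open>Closure under minors\<close>

text \<open>
  The list \<open>\<sigma>\<close> of positions says which argument of the minor is fed into each argument place of \<open>f\<close>.
  Preservation is inherited because a minor applied to tuples \<open>rs\<close> is \<open>f\<close> applied to the tuples
  selected from \<open>rs\<close> by \<open>\<sigma>\<close>, which again lie in the relation at the required sorts.
\<close>

lemma minor_in_mPol:
  assumes Q: "Q \<subseteq> Relp S A" and f: "(map ((!) w) \<sigma>, s, f) \<in> mPol S A Q"
    and w: "w \<in> lists S" and \<sigma>: "\<And>i. i \<in> set \<sigma> \<Longrightarrow> i < length w"
  shows "(w, s, \<lambda>a\<in>word_prod A w. f (map ((!) a) \<sigma>)) \<in> mPol S A Q"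
proof -
  let ?v = "map ((!) w) \<sigma>" and ?g = "\<lambda>a\<in>word_prod A w. f (map ((!) a) \<sigma>)"
  have select: "map ((!) x) \<sigma> \<in> word_prod X ?v" if "x \<in> word_prod X w" for x and X :: "'a \<Rightarrow> 'c set"
    using that \<sigma> by (auto simp: in_word_prod_iff)
  have fOp: "s \<in> S" "f \<in> word_prod A ?v \<rightarrow> A s"
    using f by (auto simp: mPol_def Op_def)
  have "?g \<in> word_prod A w \<rightarrow>\<^sub>E A s"
    using fOp(2) select by (auto)
  moreover have "preserves (w, s, ?g) q" if "q \<in> Q" for q
  proof -
    obtain m R R' where q: "q = (m, R, R')" by (cases q)
    then have R: "R t \<subseteq> tuples m (A t)" if "t \<in> set w" for t
    proof -
      have "(m, R, R') \<in> Relp S A" using Q \<open>q \<in> Q\<close> q by blast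
      with w that show ?thesis by (auto simp: Relp_iff)
    qed
    have "coordinatewise m ?g rs \<in> R' s" if rs: "rs \<in> word_prod R w" for rs
    proof -
      have "coordinatewise m ?g rs = coordinatewise m f (map ((!) rs) \<sigma>)"
        using column_in_word_prod[OF rs R] rs \<sigma>
        by (auto simp: coordinatewise_def in_word_prod_iff intro!: arg_cong[of _ _ f])
      also have "\<dots> \<in> R' s"
        using f \<open>q \<in> Q\<close> q select[OF rs] by (auto simp: mPol_def)
      finally show ?thesis .
    qed
    then show ?thesis by (simp add: q)
  qed
  ultimately show ?thesis
    using w fOp(1) by (auto simp: mPol_def Op_def)
qed

section \<open>Preservation under reflection and coreflection\<close>

lemma reflection_maps:
  assumes "is_reflection S A B h h'" "t \<in> S" "B t \<noteq> {}"
  shows "b \<in> B t \<Longrightarrow> h t b \<in> A t" and "a \<in> A t \<Longrightarrow> h' t a \<in> B t"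
  using assms by (auto simp: is_reflection_def nonempty_sorts_def)

lemma map_in_tuples:
  assumes "x \<in> tuples m X" and "\<And>y. y \<in> X \<Longrightarrow> \<phi> y \<in> Y"
  shows "map \<phi> x \<in> tuples m Y"
  using assms by (auto simp: tuples_def in_lists_conv_set)

lemma reflect_operation_in_Op:
  assumes "is_reflection S A B h h'" and "(w, s, f) \<in> Op S A" and "reasonable B w s"
  shows "reflect_operation B h h' (w, s, f) \<in> Op S B"
proof -
  have ws: "w \<in> lists S" "s \<in> S" and f: "f \<in> word_prod A w \<rightarrow> A s"
    using assms(2) by (auto simp: Op_def)
  have "h' s (f (map2 h w b)) \<in> B s" if b: "b \<in> word_prod B w" for b
  proof -
    have "map2 h w b \<in> word_prod A w"
      using b by (rule map2_in_word_prod) (use ws reflection_maps(1)[OF assms(1)] in blast)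
    moreover have "B s \<noteq> {}"
      using assms(3) b by (auto simp: reasonable_def)
    ultimately show ?thesis
      using f ws(2) reflection_maps(2)[OF assms(1)] by blast
  qed
  with ws show ?thesis by (auto simp: Op_def)
qed

lemma coreflect_in_Relp:
  assumes "is_reflection S A B h h'" and "q \<in> Relp S B"
  shows "coreflect_relation_pair S A B h h' q \<in> Relp S A"
proof -
  obtain m T T' where q: "q = (m, T, T')" by (cases q)
  have "map (h s) t \<in> tuples m (A s)" if "s \<in> S" "B s \<noteq> {}" "t \<in> T s" for s t
    using that assms(2) reflection_maps(1)[OF assms(1) that(1,2)]
    by (intro map_in_tuples[of _ m "B s"]) (auto simp: q Relp_iff)
  then show ?thesis by (auto simp: q Relp_iff)
qed

lemma reflect_in_Relp:
  assumes "is_reflection S A B h h'" and "q \<in> Relp S A"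
  shows "reflect_relation_pair S B h h' q \<in> Relp S B"
proof -
  obtain m R R' where q: "q = (m, R, R')" by (cases q)
  have "map (h' s) a \<in> tuples m (B s)" if "s \<in> S" "B s \<noteq> {}" "a \<in> R' s" for s a
    using that assms(2) reflection_maps(2)[OF assms(1) that(1,2)]
    by (intro map_in_tuples[of _ m "A s"]) (auto simp: q Relp_iff)
  then show ?thesis by (auto simp: q Relp_iff)
qed

text \<open>
  Coordinatewise, a reflection of \<open>f\<close> translates its arguments by \<open>h\<close> and the result of \<open>f\<close> by \<open>h'\<close>.
  The tuples must come from \<open>B\<close>, as outside \<open>B\<^sub>w\<close> the reflected operation is undefined.
\<close>

lemma coordinatewise_reflect:
  assumes ts: "ts \<in> word_prod T w" and T: "\<And>t. t \<in> set w \<Longrightarrow> T t \<subseteq> tuples m (B t)"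
  shows "coordinatewise m (\<lambda>b\<in>word_prod B w. h' s (f (map2 h w b))) ts =
    map (h' s) (coordinatewise m f (map2 (\<lambda>t. map (h t)) w ts))"
proof -
  have "map2 h w (map (\<lambda>r. r ! j) ts) = map (\<lambda>r. r ! j) (map2 (\<lambda>t. map (h t)) w ts)"
    if "j < m" for j
  proof (rule nth_equalityI)
    fix i assume "i < length (map2 h w (map (\<lambda>r. r ! j) ts))"
    then have i: "i < length w" "i < length ts" by auto
    then have "length (ts ! i) = m"
      using ts T[of "w ! i"] by (auto simp: in_word_prod_iff tuples_def)
    with i \<open>j < m\<close>
    show "map2 h w (map (\<lambda>r. r ! j) ts) ! i = map (\<lambda>r. r ! j) (map2 (\<lambda>t. map (h t)) w ts) ! i"
      by simp
  qed simp
  then show ?thesis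
    using column_in_word_prod[OF ts T] by (auto simp: coordinatewise_def)
qed

text \<open>
  The left side speaks of the tuples \<open>f (h ts)\<close> lying in the \<open>h'\<close>-preimage of \<open>T'\<close>, the right side of
  the tuples \<open>h' (f (h ts))\<close> lying in \<open>T'\<close>.  Nonemptiness of the components excludes the sorts at
  which a coreflection is empty by convention, even for arity zero.
\<close>

lemma preserves_coreflect_iff:
  assumes refl: "is_reflection S A B h h'" and f: "(w, s, f) \<in> Op S A" and q: "q \<in> Relp S B"
    and ne: "\<And>t. t \<in> set (s # w) \<Longrightarrow> B t \<noteq> {}"
  shows "preserves (w, s, f) (coreflect_relation_pair S A B h h' q) \<longleftrightarrow>
    preserves (reflect_operation B h h' (w, s, f)) q"
proof -
  obtain m T T' where qm: "q = (m, T, T')" by (cases q)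
  obtain R R' where coreflect: "coreflect_relation_pair S A B h h' q = (m, R, R')"
    by (simp add: qm)
  have ws: "w \<in> lists S" "s \<in> S" and fA: "f \<in> word_prod A w \<rightarrow> A s"
    using f by (auto simp: Op_def)
  have T: "T t \<subseteq> tuples m (B t)" if "t \<in> set w" for t
    using q ws that by (auto simp: qm Relp_iff)
  have R: "R t = map (h t) ` T t" if "t \<in> set w" for t
    using coreflect ne ws that by (auto simp: qm)
  have R': "R' s = {a \<in> tuples m (A s). map (h' s) a \<in> T' s}"
    using coreflect ne ws by (auto simp: qm)
  have RA: "R t \<subseteq> tuples m (A t)" if "t \<in> set w" for t
    using coreflect_in_Relp[OF refl q] ws that by (auto simp: coreflect Relp_iff)
  let ?H = "map2 (\<lambda>t. map (h t)) w"
  have H: "?H ts \<in> word_prod R w" if "ts \<in> word_prod T w" for ts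
    using that by (rule map2_in_word_prod) (auto simp: R)
  have surj: "\<exists>ts\<in>word_prod T w. rs = ?H ts" if rs: "rs \<in> word_prod R w" for rs
  proof -
    have "\<forall>i<length w. \<exists>t. t \<in> T (w ! i) \<and> rs ! i = map (h (w ! i)) t"
      using rs R by (auto simp: in_word_prod_iff)
    then obtain \<tau> where \<tau>: "\<tau> i \<in> T (w ! i) \<and> rs ! i = map (h (w ! i)) (\<tau> i)"
      if "i < length w" for i by metis
    let ?ts = "map \<tau> [0..<length w]"
    have "?ts \<in> word_prod T w" "rs = ?H ?ts"
      using \<tau> rs by (auto simp: in_word_prod_iff intro!: nth_equalityI)
    then show ?thesis by blast
  qed
  have "preserves (w, s, f) (m, R, R') \<longleftrightarrow>
      (\<forall>ts\<in>word_prod T w. coordinatewise m f (?H ts) \<in> R' s)"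
    using H surj by (simp) blast
  also have "\<dots> \<longleftrightarrow> (\<forall>ts\<in>word_prod T w. map (h' s) (coordinatewise m f (?H ts)) \<in> T' s)"
    using coordinatewise_in_tuples[OF fA H RA] by (auto simp: R')
  also have "\<dots> \<longleftrightarrow> preserves (reflect_operation B h h' (w, s, f)) q"
    using coordinatewise_reflect[OF _ T, where h = h and h' = h' and s = s and f = f]
    by (simp add: qm)
  finally show ?thesis by (simp only: coreflect)
qed

text \<open>
  At nonempty sorts the coreflection of the reflection of \<open>(R, R')\<close> has a smaller first and a larger
  second component than \<open>(R, R')\<close>, so it is preserved as well, and the previous equivalence applies.
\<close>

lemma preserves_reflect:
  assumes refl: "is_reflection S A B h h'" and f: "(w, s, f) \<in> Op S A" and q: "q \<in> Relp S A"
    and ne: "\<And>t. t \<in> set (s # w) \<Longrightarrow> B t \<noteq> {}"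
    and pres: "preserves (w, s, f) q"
  shows "preserves (reflect_operation B h h' (w, s, f)) (reflect_relation_pair S B h h' q)"
proof -
  obtain m R R' where qm: "q = (m, R, R')" by (cases q)
  let ?c = "coreflect_relation_pair S A B h h' (reflect_relation_pair S B h h' q)"
  obtain U U' where c: "?c = (m, U, U')"
    by (simp add: qm)
  have ws: "w \<in> lists S" "s \<in> S" using f by (auto simp: Op_def)
  have "U t \<subseteq> R t" if "t \<in> set w" for t
    using c ws ne that by (auto simp: qm)
  then have "word_prod U w \<subseteq> word_prod R w"
    by (auto simp: in_word_prod_iff subset_iff)
  moreover have "R' s \<subseteq> U' s"
  proof
    fix a assume a: "a \<in> R' s"
    then have "a \<in> tuples m (A s)" using q ws(2) by (auto simp: qm Relp_iff)
    with a show "a \<in> U' s" using c ws(2) ne by (auto simp: qm)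
  qed
  ultimately have "preserves (w, s, f) ?c"
    using pres unfolding c by (auto simp: qm)
  then show ?thesis
    using preserves_coreflect_iff[OF refl f reflect_in_Relp[OF refl q] ne] by blast
qed

text \<open>
  Reflected and coreflected relations are empty at such a sort \<open>t\<close>, for arity zero by convention, so
  there are no argument tuples to test.
\<close>

lemma preserves_at_empty_sort:
  assumes "t \<in> set w" "w \<in> lists S" "B t = {}"
  shows "preserves (w, s, f) (coreflect_relation_pair S A B h h' p)"
    and "preserves (w, s, g) (reflect_relation_pair S B h h' q)"
proof -
  have t: "t \<in> S" using assms by auto
  obtain m T T' where p: "p = (m, T, T')" by (cases p)
  obtain n R R' where q: "q = (n, R, R')" by (cases q)
  have "word_prod (\<lambda>s\<in>S. if B s = {} then {} else map (h s) ` T s) w = {}"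
    unfolding word_prod_empty_iff using assms t by (intro bexI[of _ t]) auto
  then show "preserves (w, s, f) (coreflect_relation_pair S A B h h' p)"
    by (simp add: p)
  have "word_prod (\<lambda>s\<in>S. if B s = {} then {} else {b \<in> tuples n (B s). map (h s) b \<in> R s}) w = {}"
    unfolding word_prod_empty_iff using assms t by (intro bexI[of _ t]) auto
  then show "preserves (w, s, g) (reflect_relation_pair S B h h' q)"
    by (simp add: q)
qed

section \<open>From reflections to relational conditions and back\<close>

lemma reflection_imp_relational_conditions:
  assumes QA: "QA \<subseteq> Relp S A" and QB: "QB \<subseteq> Relp S B"
    and refl: "is_reflection S A B h h'"
    and reas: "\<forall>(w, s, f)\<in>mPol S A QA. reasonable B w s"
    and eq: "mPol S B QB = reflect_operation B h h' ` mPol S A QA"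
  shows "coreflect_relation_pair S A B h h' ` QB \<subseteq> minor_closure S A QA"
    and "reflect_relation_pair S B h h' ` minor_closure S A QA \<subseteq> minor_closure S B QB"
proof -
  \<comment> \<open>By reasonability, an operation with an empty sort in its declaration has one among its inputs.\<close>
  have empty_input: "\<exists>t\<in>set w. B t = {}"
    if "(w, s, f) \<in> mPol S A QA" "t \<in> set (s # w)" "B t = {}" for w s f t
    using that reas by (auto simp: reasonable_def word_prod_empty_iff)
  have Op: "(w, s, f) \<in> Op S A" "w \<in> lists S" if "(w, s, f) \<in> mPol S A QA" for w s f
    using that by (auto simp: mPol_def Op_def)
  show "coreflect_relation_pair S A B h h' ` QB \<subseteq> minor_closure S A QA"
  proof
    fix p assume "p \<in> coreflect_relation_pair S A B h h' ` QB"
    then obtain q where q: "q \<in> QB" and p: "p = coreflect_relation_pair S A B h h' q" by blast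
    have "preserves (w, s, f) p" if f: "(w, s, f) \<in> mPol S A QA" for w s f
    proof (cases "\<exists>t\<in>set (s # w). B t = {}")
      case True
      with empty_input[OF f] preserves_at_empty_sort(1) Op(2)[OF f] show ?thesis
        unfolding p by metis
    next
      case False
      have "reflect_operation B h h' (w, s, f) \<in> mPol S B QB"
        using eq f by blast
      with q have "preserves (reflect_operation B h h' (w, s, f)) q"
        by (auto simp: mPol_def)
      with False show ?thesis
        using preserves_coreflect_iff[OF refl Op(1)[OF f]] q QB p by blast
    qed
    moreover have "p \<in> Relp S A"
      using coreflect_in_Relp[OF refl] q QB unfolding p by blast
    ultimately show "p \<in> minor_closure S A QA"
      by (auto simp: minor_closure_def mInv_def)
  qed
  show "reflect_relation_pair S B h h' ` minor_closure S A QA \<subseteq> minor_closure S B QB"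
  proof
    fix p assume "p \<in> reflect_relation_pair S B h h' ` minor_closure S A QA"
    then obtain q where q: "q \<in> Relp S A" "\<And>f. f \<in> mPol S A QA \<Longrightarrow> preserves f q"
      and p: "p = reflect_relation_pair S B h h' q"
      by (auto simp: minor_closure_def mInv_def)
    have "preserves (reflect_operation B h h' (w, s, f)) p"
      if f: "(w, s, f) \<in> mPol S A QA" for w s f
    proof (cases "\<exists>t\<in>set (s # w). B t = {}")
      case True
      with empty_input[OF f] obtain t where "t \<in> set w" "B t = {}" by blast
      with preserves_at_empty_sort(2) Op(2)[OF f] show ?thesis
        unfolding p reflect_operation.simps by metis
    next
      case False
      with preserves_reflect[OF refl Op(1)[OF f] q(1)] q(2)[OF f] show ?thesis
        unfolding p by blast
    qed
    then have "preserves g p" if "g \<in> mPol S B QB" for g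
      using that unfolding eq by auto
    with reflect_in_Relp[OF refl q(1)] show "p \<in> minor_closure S B QB"
      by (auto simp: minor_closure_def mInv_def p)
  qed
qed

text \<open>
  The relation pair at which preservation is tested is the one described at the beginning: preserving
  its reflection entails that the value table of \<open>g\<close> on \<open>B\<^sub>w\<close> is the \<open>h'\<close>-image of
  the value table of a minor of some member of \<open>mPol Q\<close>, evaluated at the \<open>h\<close>-images.
\<close>

lemma ex_reflection_eq:
  assumes Q: "Q \<subseteq> Relp S A" and fin: "\<And>t. t \<in> set w \<Longrightarrow> finite (B t)"
    and g: "(w, s, g) \<in> Op S B" and refl: "is_reflection S A B h h'"
    and ne: "\<And>t. t \<in> set (s # w) \<Longrightarrow> B t \<noteq> {}"
    and pres: "\<And>q. q \<in> minor_closure S A Q \<Longrightarrow>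
      preserves (w, s, g) (reflect_relation_pair S B h h' q)"
  shows "\<exists>f. (w, s, f) \<in> mPol S A Q \<and> reflect_operation B h h' (w, s, f) = (w, s, g)"
proof -
  have ws: "w \<in> lists S" "s \<in> S" and gB: "g \<in> extensional (word_prod B w)"
    using g by (auto simp: Op_def PiE_iff)
  have wS: "w ! i \<in> S" if "i < length w" for i
    using ws(1) that by (auto simp: in_lists_conv_set)
  have "finite (word_prod B w)"
    using fin by (rule finite_word_prod)
  from finite_list[OF this] obtain bs where bs: "set bs = word_prod B w" by blast
  define m where "m = length bs"
  define entries where "entries i = map (\<lambda>b. b ! i) bs" for i
  define R where "R = (\<lambda>t\<in>S. {map (h t) (entries i) | i. i < length w \<and> w ! i = t})"
  define R' where
    "R' = (\<lambda>t\<in>S. {coordinatewise m f rs | v f rs. (v, t, f) \<in> mPol S A Q \<and> rs \<in> word_prod R v})"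
  have bsB: "b \<in> word_prod B w" if "b \<in> set bs" for b
    using that bs by simp
  have entries: "entries i \<in> tuples m (B (w ! i))" if "i < length w" for i
    using that bsB by (auto simp: entries_def m_def tuples_def in_word_prod_iff)
  have RA: "R t \<subseteq> tuples m (A t)" if "t \<in> S" for t
  proof -
    have "map (h t) (entries i) \<in> tuples m (A t)" if "i < length w" "w ! i = t" for i
      using entries[OF that(1)] that ne
      by (intro map_in_tuples[of _ m "B t"] reflection_maps(1)[OF refl \<open>t \<in> S\<close>]) auto
    with that show ?thesis by (auto simp: R_def)
  qed
  have R'A: "R' t \<subseteq> tuples m (A t)" if "t \<in> S" for t
  proof -
    have "coordinatewise m f rs \<in> tuples m (A t)"
      if "(v, t, f) \<in> mPol S A Q" and rs: "rs \<in> word_prod R v" for v f rs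
    proof (rule coordinatewise_in_tuples[OF _ rs])
      show "f \<in> word_prod A v \<rightarrow> A t" using that by (auto simp: mPol_def Op_def)
      show "R u \<subseteq> tuples m (A u)" if "u \<in> set v" for u
        using RA that \<open>(v, t, f) \<in> mPol S A Q\<close> by (auto simp: mPol_def Op_def)
    qed
    with that show ?thesis by (auto simp: R'_def)
  qed
  have "(m, R, R') \<in> minor_closure S A Q"
  proof -
    have "(m, R, R') \<in> Relp S A"
      using RA R'A by (auto simp: Relp_iff R_def R'_def)
    moreover have "preserves (v, t, f) (m, R, R')" if f: "(v, t, f) \<in> mPol S A Q" for v t f
    proof -
      have "t \<in> S" using f by (auto simp: mPol_def Op_def)
      with f show ?thesis by (auto simp: R'_def)
    qed
    ultimately show ?thesis by (auto simp: minor_closure_def mInv_def)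
  qed
  from pres[OF this] have pres_R:
    "coordinatewise m g ts \<in> map (h' s) ` R' s"
    if "ts \<in> word_prod (\<lambda>t\<in>S. if B t = {} then {} else {b \<in> tuples m (B t). map (h t) b \<in> R t}) w"
    for ts
    using that ws ne by auto
  let ?ts = "map entries [0..<length w]"
  have "coordinatewise m g ?ts \<in> map (h' s) ` R' s"
  proof (rule pres_R, unfold in_word_prod_iff, intro conjI allI impI)
    fix i assume i: "i < length w"
    with entries[OF i] wS[OF i] ne[of "w ! i"]
    show "?ts ! i \<in> (\<lambda>t\<in>S. if B t = {} then {} else {b \<in> tuples m (B t). map (h t) b \<in> R t}) (w ! i)"
      by (auto simp: R_def)
  qed simp
  moreover have "coordinatewise m g ?ts = map g bs"
  proof -
    have "map (\<lambda>r. r ! j) ?ts = bs ! j" if "j < m" for j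
      using that bsB[of "bs ! j"]
      by (auto simp: m_def entries_def in_word_prod_iff intro!: nth_equalityI)
    then show ?thesis
      by (auto simp: coordinatewise_def m_def intro!: nth_equalityI)
  qed
  ultimately obtain v f rs where f: "(v, s, f) \<in> mPol S A Q" and rs: "rs \<in> word_prod R v"
    and table: "map g bs = map (h' s) (coordinatewise m f rs)"
    using ws(2) by (auto simp: R'_def)
  have vS: "v ! k \<in> S" if "k < length v" for k
    using f that by (auto simp: mPol_def Op_def in_lists_conv_set)
  have "\<exists>i<length w. w ! i = v ! k \<and> rs ! k = map (h (v ! k)) (entries i)" if "k < length v" for k
  proof -
    have "rs ! k \<in> R (v ! k)"
      using rs that by (auto simp: in_word_prod_iff)
    with vS[OF that] show ?thesis by (auto simp: R_def)
  qed
  then obtain pos where pos: "pos k < length w" "w ! pos k = v ! k"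
    "rs ! k = map (h (v ! k)) (entries (pos k))" if "k < length v" for k
    by metis
  \<comment> \<open>The \<open>k\<close>-th argument tuple of \<open>f\<close> lists \<open>h\<close>-images of entries at position \<open>pos k\<close>, so \<open>f\<close> reads its
    \<open>k\<close>-th argument from there.\<close>
  define \<sigma> where "\<sigma> = map pos [0..<length v]"
  have v: "v = map ((!) w) \<sigma>"
    using pos by (auto simp: \<sigma>_def intro: nth_equalityI)
  let ?f = "\<lambda>a\<in>word_prod A w. f (map ((!) a) \<sigma>)"
  have minor: "(w, s, ?f) \<in> mPol S A Q"
    using f ws(1) pos(1) unfolding v by (intro minor_in_mPol[OF Q]) (auto simp: \<sigma>_def)
  have "h' s (?f (map2 h w b)) = g b" if b: "b \<in> word_prod B w" for b
  proof -
    obtain j where j: "j < m" "b = bs ! j"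
      using b bs by (metis in_set_conv_nth m_def)
    have len: "length b = length w" "length rs = length v"
      using b rs by (auto simp: in_word_prod_iff)
    have "map2 h w b \<in> word_prod A w"
      using b by (rule map2_in_word_prod) (use ws(1) reflection_maps(1)[OF refl] in blast)
    moreover have "map ((!) (map2 h w b)) \<sigma> = map (\<lambda>r. r ! j) rs"
      using j len pos by (auto simp: \<sigma>_def entries_def m_def intro!: nth_equalityI)
    moreover have "g b = h' s (f (map (\<lambda>r. r ! j) rs))"
      using arg_cong[OF table, of "\<lambda>x. x ! j"] j by (simp add: coordinatewise_def m_def)
    ultimately show ?thesis by simp
  qed
  with gB have "reflect_operation B h h' (w, s, ?f) = (w, s, g)"
    by (auto simp: extensional_def)
  with minor show ?thesis by blast
qed

text \<open>
  A declaration with an empty sort occurring in it has at most one operation on \<open>B\<close>, the empty map,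
  and therefore the agreement of declarations alone matches the operations with such declarations.
\<close>

lemma reflect_operation_empty_eq:
  assumes "\<exists>t\<in>set (s # w). B t = {}" and "(w, s, g) \<in> Op S B"
  shows "reflect_operation B h h' (w, s, f) = (w, s, g)"
proof -
  have "B s \<noteq> {} \<or> word_prod B w = {}"
    using assms(2) by (auto simp: Op_def)
  with assms(1) have "word_prod B w = {}"
    by (auto simp: word_prod_empty_iff)
  with assms(2) show ?thesis by (auto simp: Op_def)
qed

lemma relational_conditions_imp_reflection:
  assumes fin: "\<forall>s\<in>S. finite (B s)" and QA: "QA \<subseteq> Relp S A" and QB: "QB \<subseteq> Relp S B"
    and agree: "agree_at_empty_sorts S B (mPol S A QA) (mPol S B QB)"
    and refl: "is_reflection S A B h h'"
    and coreflect: "coreflect_relation_pair S A B h h' ` QB \<subseteq> minor_closure S A QA"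
    and reflect: "reflect_relation_pair S B h h' ` minor_closure S A QA \<subseteq> minor_closure S B QB"
  shows "\<forall>(w, s, f)\<in>mPol S A QA. reasonable B w s"
    and "mPol S B QB = reflect_operation B h h' ` mPol S A QA"
proof -
  have OpA: "(w, s, f) \<in> Op S A" "w \<in> lists S" "s \<in> S" if "(w, s, f) \<in> mPol S A QA" for w s f
    using that by (auto simp: mPol_def Op_def)
  have OpB: "(w, s, g) \<in> Op S B" "w \<in> lists S" "s \<in> S" if "(w, s, g) \<in> mPol S B QB" for w s g
    using that by (auto simp: mPol_def Op_def)
  have same_decl: "(\<exists>f. (w, s, f) \<in> mPol S A QA) \<longleftrightarrow> (\<exists>g. (w, s, g) \<in> mPol S B QB)"
    if "w \<in> lists S" "s \<in> S" "\<exists>t\<in>set (s # w). B t = {}" for w s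
    using agree that unfolding agree_at_empty_sorts_def by blast
  have reas: "reasonable B w s" if f: "(w, s, f) \<in> mPol S A QA" for w s f
  proof (cases "B s = {}")
    case True
    then obtain g where "(w, s, g) \<in> mPol S B QB"
      using same_decl[OF OpA(2,3)[OF f]] f by auto
    then have "g \<in> word_prod B w \<rightarrow> B s"
      by (auto simp: mPol_def Op_def)
    then show ?thesis by (auto simp: reasonable_def)
  qed (simp add: reasonable_def)
  then show "\<forall>(w, s, f)\<in>mPol S A QA. reasonable B w s" by blast
  have "reflect_operation B h h' (w, s, f) \<in> mPol S B QB" if f: "(w, s, f) \<in> mPol S A QA" for w s f
  proof (cases "\<exists>t\<in>set (s # w). B t = {}")
    case True
    then obtain g where g: "(w, s, g) \<in> mPol S B QB"
      using same_decl[OF OpA(2,3)[OF f]] f by blast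
    with reflect_operation_empty_eq[OF True OpB(1)[OF g]] show ?thesis by metis
  next
    case False
    have "preserves (w, s, f) (coreflect_relation_pair S A B h h' q)" if "q \<in> QB" for q
      using that f coreflect by (auto simp: minor_closure_def mInv_def image_subset_iff)
    then have "preserves (reflect_operation B h h' (w, s, f)) q" if "q \<in> QB" for q
      using that False QB preserves_coreflect_iff[OF refl OpA(1)[OF f]] by blast
    with reflect_operation_in_Op[OF refl OpA(1)[OF f] reas[OF f]] show ?thesis
      by (simp add: mPol_def)
  qed
  moreover have "\<exists>f. (w, s, f) \<in> mPol S A QA \<and> reflect_operation B h h' (w, s, f) = (w, s, g)"
    if g: "(w, s, g) \<in> mPol S B QB" for w s g
  proof (cases "\<exists>t\<in>set (s # w). B t = {}")
    case True
    then obtain f where "(w, s, f) \<in> mPol S A QA"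
      using same_decl[OF OpB(2,3)[OF g]] g by blast
    with reflect_operation_empty_eq[OF True OpB(1)[OF g]] show ?thesis by metis
  next
    case False
    show ?thesis
    proof (rule ex_reflection_eq[OF QA _ OpB(1)[OF g] refl])
      show "finite (B t)" if "t \<in> set w" for t
        using that OpB(2)[OF g] fin by blast
      show "B t \<noteq> {}" if "t \<in> set (s # w)" for t
        using that False by blast
      show "preserves (w, s, g) (reflect_relation_pair S B h h' q)"
        if "q \<in> minor_closure S A QA" for q
        using that g reflect unfolding minor_closure_def[of S B] mInv_def by blast
    qed
  qed
  ultimately show "mPol S B QB = reflect_operation B h h' ` mPol S A QA"
    by (auto simp: image_iff simp del: reflect_operation.simps) metis+
qed

theorem proposition4p6:
  fixes S :: "'s set" and A :: "'s \<Rightarrow> 'a set" and B :: "'s \<Rightarrow> 'b set"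
    and QA :: "('s, 'a) relation_pair set" and QB :: "('s, 'b) relation_pair set"
    and M1 :: "('s, 'a) operation set" and M2 :: "('s, 'b) operation set"
  assumes "\<forall>s\<in>S. finite (A s)" and "\<forall>s\<in>S. finite (B s)"
    and "QA \<subseteq> Relp S A" and "QB \<subseteq> Relp S B"
    and "M1 = mPol S A QA" and "M2 = mPol S B QB"
    and "agree_at_empty_sorts S B M1 M2"
  shows "M2 \<in> reflections S A B M1 \<longleftrightarrow>
    (\<exists>h h'. is_reflection S A B h h' \<and>
       coreflect_relation_pair S A B h h' ` QB \<subseteq> minor_closure S A QA \<and>
       reflect_relation_pair S B h h' ` minor_closure S A QA \<subseteq> minor_closure S B QB)"
proof
  assume "M2 \<in> reflections S A B M1"
  then obtain h h' where "is_reflection S A B h h'"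
    and "\<forall>(w, s, f)\<in>mPol S A QA. reasonable B w s"
    and "mPol S B QB = reflect_operation B h h' ` mPol S A QA"
    unfolding reflections_def assms(5,6) by blast
  with reflection_imp_relational_conditions[OF assms(3,4) this]
  show "\<exists>h h'. is_reflection S A B h h' \<and>
       coreflect_relation_pair S A B h h' ` QB \<subseteq> minor_closure S A QA \<and>
       reflect_relation_pair S B h h' ` minor_closure S A QA \<subseteq> minor_closure S B QB"
    by blast
next
  assume "\<exists>h h'. is_reflection S A B h h' \<and>
       coreflect_relation_pair S A B h h' ` QB \<subseteq> minor_closure S A QA \<and>
       reflect_relation_pair S B h h' ` minor_closure S A QA \<subseteq> minor_closure S B QB"
  then obtain h h' where *: "is_reflection S A B h h'"
    "coreflect_relation_pair S A B h h' ` QB \<subseteq> minor_closure S A QA"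
    "reflect_relation_pair S B h h' ` minor_closure S A QA \<subseteq> minor_closure S B QB"
    by blast
  note conditions = relational_conditions_imp_reflection[OF assms(2-4) assms(7)[unfolded assms(5,6)] *]
  from conditions(1) conditions(2) *(1) show "M2 \<in> reflections S A B M1"
    unfolding reflections_def assms(5,6) by blast
qed

end
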